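(* Let $k_\mathcal{G}=n_\mathcal{G}\ge1$ and $k_\mathcal{H}=n_\mathcal{H}-1\ge1$. Let real numbers $\lambda_{g,i}$ ($g\in V(\mathcal{G})$, $1\le i\le n_\mathcal{G}-1$) satisfy $\sum_{i=1}^{n_\mathcal{G}-1}\lambda_{g,i}^2=n_\mathcal{G}-1$ for all $g\in V(\mathcal{G})$ and $\sum_{i=1}^{n_\mathcal{G}-1}\lambda_{g,i}\lambda_{g',i}=-1$ for all 2-element subsets $\{g,g'\}\subseteq V(\mathcal{G})$. Let $s'_i=\frac1{\sqrt{n_\mathcal{G}}}\sum_{g\in V(\mathcal{G})}\lambda_{g,i}\sum_{h\in V(\mathcal{H})}x_{gh}$ for $1\le i\le n_\mathcal{G}-1$, and $s'_{n_\mathcal{G}}=\frac1{\sqrt{n_\mathcal{G}}}\big(-k_\mathcal{G}k_\mathcal{H}+\sum_{g\in V(\mathcal{G}),h\in V(\mathcal{H})}x_{gh}\big)$. Then $s'_1,\dots,s'_{n_\mathcal{G}}$ form a $1$-sum-of-squares certificate of $f_{\mathrm{viz}}$, i.e. $f_{\mathrm{viz}}\equiv\sum_{i=1}^{n_\mathcal{G}}(s'_i)^2\pmod{I_{\mathrm{viz}}}$; consequently $\gamma(G)\gamma(H)\le\gamma(G\Box H)$ for all graphs $G$ on $n_\mathcal{G}$ vertices with domination number $n_\mathcal{G}$ and $H$ on $n_\mathcal{H}$ vertices with domination number $n_\mathcal{H}-1$.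
   Context: $\mathbb{K}=\mathbb{R}$ (or a subfield of $\mathbb{R}$ containing all coefficients used). $V(\mathcal{G})$ is a set of $n_\mathcal{G}$ vertices with fixed subset $D_\mathcal{G}$ of size $k_\mathcal{G}$; $V(\mathcal{H})$ a disjoint set of $n_\mathcal{H}$ vertices with fixed subset $D_\mathcal{H}$ of size $k_\mathcal{H}$. Variables $e_{gg'}=e_{g'g}$ for 2-subsets of $V(\mathcal{G})$, $e_{hh'}$ for 2-subsets of $V(\mathcal{H})$, $x_{gh}$ for $g\in V(\mathcal{G}),h\in V(\mathcal{H})$; $P$ is the polynomial ring over $\mathbb{K}$ in these. $I_{\mathrm{viz}}\subseteq P$ is generated by: $e_{gg'}^2-e_{gg'}$; $\prod_{g'\in D_\mathcal{G}}(1-e_{gg'})$ for $g\in V(\mathcal{G})\setminus D_\mathcal{G}$; $\prod_{g'\in V(\mathcal{G})\setminus S}\sum_{g\in S}e_{gg'}$ for $S\subseteq V(\mathcal{G})$, $|S|=k_\mathcal{G}-1$; the same three families for $\mathcal{H}$; $x_{gh}^2-x_{gh}$; and $(1-x_{gh})\prod_{g'\ne g}(1-e_{gg'}x_{g'h})\prod_{h'\ne h}(1-e_{hh'}x_{gh'})$ for all $g,h$. $f_{\mathrm{viz}}=\sum_{g,h}x_{gh}-k_\mathcal{G}k_\mathcal{H}$. $\gamma(\cdot)$ is the domination number; $G\Box H$ the Cartesian product graph. An $\ell$-sum-of-squares certificate of $f$ modulo $I$ is a family of polynomials of degree $\le\ell$ whose sum of squares is congruent to $f$ modulo $I$. *)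

theory Defs
  imports
    "HOL-Library.Poly_Mapping"
    "HOL-Algebra.Subrings"
    "HOL-Algebra.Algebraic_Closure_Type"
    Complex_Main
begin

section \<open>Multivariate polynomials\<close>

text \<open>A monomial is a finitely supported exponent vector and a polynomial is a finitely
  supported map from monomials to coefficients; multiplication on this type is convolution.\<close>

type_synonym 'v rpoly = "('v \<Rightarrow>\<^sub>0 nat) \<Rightarrow>\<^sub>0 real"

definition Const :: "real \<Rightarrow> 'v rpoly" where
  "Const c = Poly_Mapping.single 0 c"

definition Var :: "'v \<Rightarrow> 'v rpoly" where
  "Var v = Poly_Mapping.single (Poly_Mapping.single v 1) 1"

definition total_degree :: "'v rpoly \<Rightarrow> nat" where
  "total_degree p =
     Max (insert 0 ((\<lambda>m. \<Sum>v\<in>Poly_Mapping.keys m. Poly_Mapping.lookup m v) ` Poly_Mapping.keys p))"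

definition polys_over :: "real set \<Rightarrow> 'v set \<Rightarrow> 'v rpoly set" where
  "polys_over K vs = {p. \<forall>m\<in>Poly_Mapping.keys p.
     Poly_Mapping.keys m \<subseteq> vs \<and> Poly_Mapping.lookup p m \<in> K}"

abbreviation real_ring :: "real ring" where
  "real_ring \<equiv> ring_of_type_algebra"

definition poly_ring_over :: "real set \<Rightarrow> 'v set \<Rightarrow> 'v rpoly ring" where
  "poly_ring_over K vs = ring_of_type_algebra\<lparr>carrier := polys_over K vs\<rparr>"

definition sos_certificate ::
    "'v rpoly ring \<Rightarrow> nat \<Rightarrow> 'v rpoly set \<Rightarrow> 'v rpoly \<Rightarrow> 'i set \<Rightarrow> ('i \<Rightarrow> 'v rpoly) \<Rightarrow> bool" where
  "sos_certificate P l I f A s \<longleftrightarrow>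
     finite A \<and> (\<forall>i\<in>A. s i \<in> carrier P \<and> total_degree (s i) \<le> l) \<and> f - (\<Sum>i\<in>A. (s i)\<^sup>2) \<in> I"


section \<open>The Vizing ideal\<close>

text \<open>The edge variables are indexed by 2-element sets, which makes the index symmetric. The
  constructors keep the variables of the two graphs apart, so the vertex sets need not be
  assumed disjoint.\<close>

datatype ('a, 'b) viz_var = EG "'a set" | EH "'b set" | XGH 'a 'b

definition viz_vars :: "'a set \<Rightarrow> 'b set \<Rightarrow> ('a, 'b) viz_var set" where
  "viz_vars VG VH =
     EG ` {e. e \<subseteq> VG \<and> card e = 2} \<union> EH ` {e. e \<subseteq> VH \<and> card e = 2} \<union> (\<lambda>(g, h). XGH g h) ` (VG \<times> VH)"

abbreviation eG :: "'a \<Rightarrow> 'a \<Rightarrow> ('a, 'b) viz_var rpoly" where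
  "eG g g' \<equiv> Var (EG {g, g'})"

abbreviation eH :: "'b \<Rightarrow> 'b \<Rightarrow> ('a, 'b) viz_var rpoly" where
  "eH h h' \<equiv> Var (EH {h, h'})"

abbreviation xx :: "'a \<Rightarrow> 'b \<Rightarrow> ('a, 'b) viz_var rpoly" where
  "xx g h \<equiv> Var (XGH g h)"

text \<open>The zeros of the following polynomials are the graphs on \<open>V\<close> for which \<open>D\<close> is a
  dominating set and no set of \<open>card D - 1\<close> vertices is dominating. The set \<open>D\<close> is meant to be
  nonempty, so that the subtraction on natural numbers does not truncate.\<close>

definition dom_gens :: "('c \<Rightarrow> 'c \<Rightarrow> 'v rpoly) \<Rightarrow> 'c set \<Rightarrow> 'c set \<Rightarrow> 'v rpoly set" where
  "dom_gens e V D =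
     {(e v v')\<^sup>2 - e v v' | v v'. v \<in> V \<and> v' \<in> V \<and> v \<noteq> v'} \<union>
     {(\<Prod>v'\<in>D. 1 - e v v') | v. v \<in> V - D} \<union>
     {(\<Prod>v'\<in>V - S. \<Sum>v\<in>S. e v v') | S. S \<subseteq> V \<and> card S = card D - 1}"

definition box_gens :: "'a set \<Rightarrow> 'b set \<Rightarrow> ('a, 'b) viz_var rpoly set" where
  "box_gens VG VH =
     {(xx g h)\<^sup>2 - xx g h | g h. g \<in> VG \<and> h \<in> VH} \<union>
     {(1 - xx g h) * (\<Prod>g'\<in>VG - {g}. 1 - eG g g' * xx g' h)
                   * (\<Prod>h'\<in>VH - {h}. 1 - eH h h' * xx g h') | g h. g \<in> VG \<and> h \<in> VH}"

definition viz_ring :: "real set \<Rightarrow> 'a set \<Rightarrow> 'b set \<Rightarrow> ('a, 'b) viz_var rpoly ring" where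
  "viz_ring K VG VH = poly_ring_over K (viz_vars VG VH)"

definition viz_ideal ::
    "real set \<Rightarrow> 'a set \<Rightarrow> 'a set \<Rightarrow> 'b set \<Rightarrow> 'b set \<Rightarrow> ('a, 'b) viz_var rpoly set" where
  "viz_ideal K VG DG VH DH =
     Idl\<^bsub>viz_ring K VG VH\<^esub> (dom_gens eG VG DG \<union> dom_gens eH VH DH \<union> box_gens VG VH)"

definition f_viz :: "'a set \<Rightarrow> 'a set \<Rightarrow> 'b set \<Rightarrow> 'b set \<Rightarrow> ('a, 'b) viz_var rpoly" where
  "f_viz VG DG VH DH = (\<Sum>g\<in>VG. \<Sum>h\<in>VH. xx g h) - Const (real (card DG) * real (card DH))"


section \<open>Graphs and domination\<close>

definition simple_graph :: "'a set \<Rightarrow> 'a set set \<Rightarrow> bool" where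
  "simple_graph V E \<longleftrightarrow> finite V \<and> (\<forall>e\<in>E. e \<subseteq> V \<and> card e = 2)"

definition dominating_set :: "'a set \<Rightarrow> 'a set set \<Rightarrow> 'a set \<Rightarrow> bool" where
  "dominating_set V E D \<longleftrightarrow> D \<subseteq> V \<and> (\<forall>v\<in>V - D. \<exists>u\<in>D. {u, v} \<in> E)"

definition domination_number :: "'a set \<Rightarrow> 'a set set \<Rightarrow> nat" where
  "domination_number V E = Min (card ` {D. dominating_set V E D})"

definition box_edges ::
    "'a set \<Rightarrow> 'a set set \<Rightarrow> 'b set \<Rightarrow> 'b set set \<Rightarrow> ('a \<times> 'b) set set" where
  "box_edges V E W F =
     {{(g, h), (g, h')} | g h h'. g \<in> V \<and> {h, h'} \<in> F} \<union>
     {{(g, h), (g', h)} | g g' h. h \<in> W \<and> {g, g'} \<in> E}"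


section \<open>Well-formedness of the polynomial ring\<close>

lemma polys_over_one:
  assumes "1 \<in> K" shows "1 \<in> polys_over K vs"
  using assms by (auto simp: polys_over_def lookup_one when_def split: if_splits)

lemma polys_over_uminus:
  assumes "\<And>a. a \<in> K \<Longrightarrow> - a \<in> K" "p \<in> polys_over K vs"
  shows "- p \<in> polys_over K vs"
  using assms by (auto simp: polys_over_def)

lemma polys_over_add:
  assumes "0 \<in> K" "\<And>a b. a \<in> K \<Longrightarrow> b \<in> K \<Longrightarrow> a + b \<in> K"
    and "p \<in> polys_over K vs" "q \<in> polys_over K vs"
  shows "p + q \<in> polys_over K vs"
proof -
  have K: "Poly_Mapping.lookup r m \<in> K" if "r \<in> polys_over K vs" for r m
    using that assms(1) by (cases "m \<in> Poly_Mapping.keys r") (auto simp: polys_over_def in_keys_iff)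
  have "Poly_Mapping.keys m \<subseteq> vs" if "m \<in> Poly_Mapping.keys (p + q)" for m
    using that assms(3,4) keys_add[of p q] by (auto simp: polys_over_def)
  with K[OF assms(3)] K[OF assms(4)] assms(2) show ?thesis
    by (auto simp: polys_over_def lookup_add)
qed

lemma polys_over_single_mult:
  assumes "0 \<in> K" "\<And>a b. a \<in> K \<Longrightarrow> b \<in> K \<Longrightarrow> a * b \<in> K"
    and "a \<in> K" "Poly_Mapping.keys m \<subseteq> vs" "b \<in> K" "Poly_Mapping.keys n \<subseteq> vs"
  shows "Poly_Mapping.single m a * Poly_Mapping.single n b \<in> polys_over K vs"
  using assms keys_add[of m n]
  by (auto simp: polys_over_def mult_single lookup_single when_def split: if_splits)

lemma polys_over_sum:
  assumes "0 \<in> K" "\<And>a b. a \<in> K \<Longrightarrow> b \<in> K \<Longrightarrow> a + b \<in> K"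
    and "\<And>i. i \<in> A \<Longrightarrow> f i \<in> polys_over K vs"
  shows "(\<Sum>i\<in>A. f i) \<in> polys_over K vs"
  using assms(3)
proof (induction A rule: infinite_finite_induct)
  case (insert x A)
  have "f x \<in> polys_over K vs" "sum f A \<in> polys_over K vs"
    using insert by auto
  then have "f x + sum f A \<in> polys_over K vs"
    using polys_over_add[OF assms(1,2)] by blast
  with insert.hyps show ?case by simp
qed (auto simp: polys_over_def)

lemma rpoly_as_sum:
  fixes p :: "'v rpoly"
  shows "p = (\<Sum>m\<in>Poly_Mapping.keys p. Poly_Mapping.single m (Poly_Mapping.lookup p m))"
  by (rule poly_mapping_eqI)
     (auto simp: lookup_sum lookup_single when_def in_keys_iff sum.delta)

lemma polys_over_mult:
  assumes "0 \<in> K" "\<And>a b. a \<in> K \<Longrightarrow> b \<in> K \<Longrightarrow> a + b \<in> K"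
    "\<And>a b. a \<in> K \<Longrightarrow> b \<in> K \<Longrightarrow> a * b \<in> K"
    and "p \<in> polys_over K vs" "q \<in> polys_over K vs"
  shows "p * q \<in> polys_over K vs"
proof -
  have "p * q = (\<Sum>m\<in>Poly_Mapping.keys p. Poly_Mapping.single m (Poly_Mapping.lookup p m)) *
                (\<Sum>n\<in>Poly_Mapping.keys q. Poly_Mapping.single n (Poly_Mapping.lookup q n))"
    using rpoly_as_sum[of p] rpoly_as_sum[of q] by simp
  also have "\<dots> = (\<Sum>m\<in>Poly_Mapping.keys p. \<Sum>n\<in>Poly_Mapping.keys q.
      Poly_Mapping.single m (Poly_Mapping.lookup p m) *
      Poly_Mapping.single n (Poly_Mapping.lookup q n))"
    by (rule sum_product)
  also have "\<dots> \<in> polys_over K vs"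
    using assms(4,5)
    by (intro polys_over_sum assms(1,2) polys_over_single_mult assms(3))
       (auto simp: polys_over_def)
  finally show ?thesis .
qed

lemma subfield_real_ringD:
  assumes "subfield K real_ring"
  shows "0 \<in> K" "1 \<in> K" "a \<in> K \<Longrightarrow> - a \<in> K"
    "a \<in> K \<Longrightarrow> b \<in> K \<Longrightarrow> a + b \<in> K" "a \<in> K \<Longrightarrow> b \<in> K \<Longrightarrow> a * b \<in> K"
proof -
  interpret R: cring real_ring by (rule cring_from_type_algebra)
  note K = subringE[OF subfieldE(1)[OF assms]]
  have "\<ominus>\<^bsub>real_ring\<^esub> a = - a"
    by (rule R.add.inv_equality) (auto simp: ring_of_type_algebra_def)
  with K(2,3,5-7) show "0 \<in> K" "1 \<in> K" "a \<in> K \<Longrightarrow> - a \<in> K"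
    "a \<in> K \<Longrightarrow> b \<in> K \<Longrightarrow> a + b \<in> K" "a \<in> K \<Longrightarrow> b \<in> K \<Longrightarrow> a * b \<in> K"
    by (force simp: ring_of_type_algebra_def)+
qed

lemma cring_poly_ring_over:
  fixes vs :: "'v set"
  assumes "subfield K real_ring"
  shows "cring (poly_ring_over K vs)"
proof -
  note K = subfield_real_ringD[OF assms]
  interpret R: cring "ring_of_type_algebra :: 'v rpoly ring" by (rule cring_from_type_algebra)
  have minus: "\<ominus>\<^bsub>ring_of_type_algebra\<^esub> p = - p" for p :: "'v rpoly"
    by (rule R.add.inv_equality) (auto simp: ring_of_type_algebra_def)
  have "subring (polys_over K vs) ring_of_type_algebra"
  proof (rule R.subringI)
    show "polys_over K vs \<subseteq> carrier ring_of_type_algebra"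
      by (simp add: ring_of_type_algebra_def)
    show "\<one>\<^bsub>ring_of_type_algebra\<^esub> \<in> polys_over K vs"
      using polys_over_one[OF K(2)] by (simp add: ring_of_type_algebra_def)
  next
    fix p assume "p \<in> polys_over K vs"
    then show "\<ominus>\<^bsub>ring_of_type_algebra\<^esub> p \<in> polys_over K vs"
      using polys_over_uminus[of K p vs] K(3) by (simp add: minus)
  next
    fix p q assume "p \<in> polys_over K vs" "q \<in> polys_over K vs"
    then have "p * q \<in> polys_over K vs" "p + q \<in> polys_over K vs"
      using K by (blast intro: polys_over_mult polys_over_add)+
    then show "p \<otimes>\<^bsub>ring_of_type_algebra\<^esub> q \<in> polys_over K vs"
      "p \<oplus>\<^bsub>ring_of_type_algebra\<^esub> q \<in> polys_over K vs"
      by (simp_all add: ring_of_type_algebra_def)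
  qed
  then have "subcring (polys_over K vs) ring_of_type_algebra"
    by (rule R.subcringI')
  then show ?thesis
    unfolding poly_ring_over_def
    using R.subcring_iff[of "polys_over K vs"] by (auto simp: ring_of_type_algebra_def)
qed

lemma polys_over_prod:
  assumes "subfield K real_ring" and "\<And>i. i \<in> A \<Longrightarrow> f i \<in> polys_over K vs"
  shows "(\<Prod>i\<in>A. f i) \<in> polys_over K vs"
  using assms(2)
proof (induction A rule: infinite_finite_induct)
  note K = subfield_real_ringD[OF assms(1)]
  case (insert x A)
  have "f x \<in> polys_over K vs" "prod f A \<in> polys_over K vs"
    using insert by auto
  then have "f x * prod f A \<in> polys_over K vs"
    using polys_over_mult[OF K(1) K(4) K(5)] by blast
  with insert.hyps show ?case by simp
qed (use polys_over_one[OF subfield_real_ringD(2)[OF assms(1)]] in auto)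

lemma polys_over_diff:
  assumes "subfield K real_ring" "p \<in> polys_over K vs" "q \<in> polys_over K vs"
  shows "p - q \<in> polys_over K vs"
proof -
  note K = subfield_real_ringD[OF assms(1)]
  have "- q \<in> polys_over K vs"
    using polys_over_uminus[OF K(3) assms(3)] .
  then have "p + - q \<in> polys_over K vs"
    using polys_over_add[OF K(1) K(4) assms(2)] by blast
  then show ?thesis by simp
qed

lemma polys_over_Var:
  assumes "1 \<in> K" "v \<in> vs"
  shows "Var v \<in> polys_over K vs"
  using assms by (auto simp: polys_over_def Var_def)

lemma dom_gens_subset:
  assumes "subfield K real_ring" "D \<subseteq> V"
    and e: "\<And>v v'. v \<in> V \<Longrightarrow> v' \<in> V \<Longrightarrow> v \<noteq> v' \<Longrightarrow> e v v' \<in> polys_over K vs"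
  shows "dom_gens e V D \<subseteq> polys_over K vs"
proof -
  note K = subfield_real_ringD[OF assms(1)]
  have 1: "1 \<in> polys_over K vs" by (rule polys_over_one[OF K(2)])
  have A: "(e v v')\<^sup>2 - e v v' \<in> polys_over K vs" if "v \<in> V" "v' \<in> V" "v \<noteq> v'" for v v'
    unfolding power2_eq_square
    by (intro polys_over_diff[OF assms(1)] polys_over_mult K e that)
  have B: "(\<Prod>v'\<in>D. 1 - e v v') \<in> polys_over K vs" if "v \<in> V - D" for v
    by (intro polys_over_prod[OF assms(1)] polys_over_diff[OF assms(1)] 1 e)
       (use that assms(2) in auto)
  have C: "(\<Prod>v'\<in>V - S. \<Sum>v\<in>S. e v v') \<in> polys_over K vs" if "S \<subseteq> V" for S
    by (intro polys_over_prod[OF assms(1)] polys_over_sum K e) (use that in auto)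
  show ?thesis
    using A B C unfolding dom_gens_def by blast
qed

lemma box_gens_subset:
  assumes "subfield K real_ring"
  shows "box_gens VG VH \<subseteq> polys_over K (viz_vars VG VH)"
proof -
  note K = subfield_real_ringD[OF assms(1)]
  have 1: "1 \<in> polys_over K (viz_vars VG VH)" by (rule polys_over_one[OF K(2)])
  have x: "xx g h \<in> polys_over K (viz_vars VG VH)" if "g \<in> VG" "h \<in> VH" for g h
    by (rule polys_over_Var[OF K(2)]) (use that in \<open>auto simp: viz_vars_def\<close>)
  have eG: "eG g g' \<in> polys_over K (viz_vars VG VH)" if "g \<in> VG" "g' \<in> VG" "g \<noteq> g'" for g g'
    by (rule polys_over_Var[OF K(2)]) (use that in \<open>auto simp: viz_vars_def\<close>)
  have eH: "eH h h' \<in> polys_over K (viz_vars VG VH)" if "h \<in> VH" "h' \<in> VH" "h \<noteq> h'" for h h'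
    by (rule polys_over_Var[OF K(2)]) (use that in \<open>auto simp: viz_vars_def\<close>)
  have A: "(xx g h)\<^sup>2 - xx g h \<in> polys_over K (viz_vars VG VH)" if "g \<in> VG" "h \<in> VH" for g h
    unfolding power2_eq_square
    by (intro polys_over_diff[OF assms(1)] polys_over_mult K x that)
  have B: "(1 - xx g h) * (\<Prod>g'\<in>VG - {g}. 1 - eG g g' * xx g' h)
      * (\<Prod>h'\<in>VH - {h}. 1 - eH h h' * xx g h') \<in> polys_over K (viz_vars VG VH)"
    if "g \<in> VG" "h \<in> VH" for g h
    by (intro polys_over_mult polys_over_prod[OF assms(1)] polys_over_diff[OF assms(1)] 1 x eG eH K)
       (use that in auto)
  show ?thesis
    using A B unfolding box_gens_def by blast
qed

text \<open>The set of ideals intersected in \<open>viz_ideal\<close> is therefore not empty.\<close>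

lemma ideal_viz_ideal:
  assumes "subfield K real_ring" "DG \<subseteq> VG" "DH \<subseteq> VH"
  shows "ideal (viz_ideal K VG DG VH DH) (viz_ring K VG VH)"
proof -
  interpret P: cring "viz_ring K VG VH"
    unfolding viz_ring_def by (rule cring_poly_ring_over[OF assms(1)])
  note one = subfield_real_ringD(2)[OF assms(1)]
  have "dom_gens eG VG DG \<subseteq> polys_over K (viz_vars VG VH)"
    by (intro dom_gens_subset assms polys_over_Var one) (auto simp: viz_vars_def)
  moreover have "dom_gens eH VH DH \<subseteq> polys_over K (viz_vars VG VH)"
    by (intro dom_gens_subset assms polys_over_Var one) (auto simp: viz_vars_def)
  moreover have "box_gens VG VH \<subseteq> polys_over K (viz_vars VG VH)"
    by (rule box_gens_subset[OF assms(1)])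
  ultimately show ?thesis
    unfolding viz_ideal_def
    by (intro P.genideal_ideal) (simp add: viz_ring_def poly_ring_over_def)
qed

end

theory Submission
  imports Defs
begin

text \<open>Put \<open>Y g = (\<Sum>h\<in>VH. x g h)\<close> and \<open>k = card VH - 1\<close>. The conditions on \<open>lam\<close> say that the
  coefficient matrix is orthogonal, so the sum of the squares is \<open>\<Sum>g\<in>VG. (Y g - k)\<^sup>2\<close>, while
  \<open>f_viz\<close> is \<open>\<Sum>g\<in>VG. Y g - k\<close>; it remains to see that each \<open>Y g - k\<close> is idempotent modulo the ideal.
  A sum of idempotents lying in the ideal has all its summands there, since the coefficients have
  characteristic \<open>0\<close>. Hence all edge variables of the first graph vanish, and so do the products
  \<open>e a h * e b h'\<close> for distinct \<open>h, h'\<close> and \<open>a, b\<close> outside \<open>{h, h'}\<close>. Domination in the product then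
  forces \<open>(1 - x g h) * (1 - x g h') = 0\<close>: at most one \<open>x g h\<close> in each row is \<open>0\<close>.

  Vizing's inequality itself needs no polynomials: a graph whose domination number is its number of
  vertices has no edges, so a dominating set of the product dominates each copy of the second graph.\<close>

section \<open>Idempotents modulo an ideal of a subring\<close>

text \<open>\<open>P\<close> stands for the polynomials over \<open>K\<close> in the Vizing
  variables. \<open>I\<close> is an ideal of that subring, not of the whole type, so multipliers
  must be shown to lie in \<open>P\<close>. Stating closure with type-class operations keeps
  \<open>algebra_simps\<close> usable, and \<open>torsion_free\<close> records division by positive
  integers.\<close>

locale torsion_free_ideal =
  fixes P I :: "'r::comm_ring_1 set"
  assumes one_P [intro]: "1 \<in> P"
    and add_P [intro]: "a \<in> P \<Longrightarrow> b \<in> P \<Longrightarrow> a + b \<in> P"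
    and diff_P [intro]: "a \<in> P \<Longrightarrow> b \<in> P \<Longrightarrow> a - b \<in> P"
    and mult_P [intro]: "a \<in> P \<Longrightarrow> b \<in> P \<Longrightarrow> a * b \<in> P"
    and zero_I [intro]: "0 \<in> I"
    and add_I [intro]: "a \<in> I \<Longrightarrow> b \<in> I \<Longrightarrow> a + b \<in> I"
    and mult_I: "p \<in> P \<Longrightarrow> a \<in> I \<Longrightarrow> p * a \<in> I"
    and torsion_free: "a \<in> P \<Longrightarrow> of_nat (Suc n) * a \<in> I \<Longrightarrow> a \<in> I"
begin

lemma zero_P [intro]: "0 \<in> P"
  using diff_P[OF one_P one_P] by simp

lemma sum_P: "(\<And>j. j \<in> J \<Longrightarrow> f j \<in> P) \<Longrightarrow> sum f J \<in> P"
  by (induction J rule: infinite_finite_induct) auto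

lemma prod_P: "(\<And>j. j \<in> J \<Longrightarrow> f j \<in> P) \<Longrightarrow> prod f J \<in> P"
  by (induction J rule: infinite_finite_induct) auto

lemma sum_I: "(\<And>j. j \<in> J \<Longrightarrow> f j \<in> I) \<Longrightarrow> sum f J \<in> I"
  by (induction J rule: infinite_finite_induct) auto

lemma uminus_I: "a \<in> I \<Longrightarrow> - a \<in> I"
  using mult_I[OF diff_P[OF zero_P one_P], of a] by simp

lemma diff_I [intro]: "a \<in> I \<Longrightarrow> b \<in> I \<Longrightarrow> a - b \<in> I"
  using add_I[OF _ uminus_I, of a b] by simp

lemma idempotent_mult:
  assumes "e \<in> P" "f \<in> P" "e\<^sup>2 - e \<in> I" "f\<^sup>2 - f \<in> I"
  shows "(e * f)\<^sup>2 - e * f \<in> I"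
proof -
  have "(e * f)\<^sup>2 - e * f = e * e * (f\<^sup>2 - f) + f * (e\<^sup>2 - e)"
    by (simp add: algebra_simps power2_eq_square)
  then show ?thesis
    using assms by (auto intro: mult_I)
qed

text \<open>Where each \<open>f j\<close> is 0 or 1, the second factor is a positive integer, so it
  can be cancelled. The induction splits by the value of one idempotent, which is why
  \<open>a\<close> and \<open>c\<close> vary.\<close>

lemma positive_plus_idempotents_cancel:
  assumes "finite J" "\<And>j. j \<in> J \<Longrightarrow> f j \<in> P" "\<And>j. j \<in> J \<Longrightarrow> (f j)\<^sup>2 - f j \<in> I"
    and "a \<in> P" "a * (of_nat (Suc c) + (\<Sum>j\<in>J. f j)) \<in> I"
  shows "a \<in> I"
  using assms
proof (induction J arbitrary: a c rule: finite_induct)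
  case empty
  then show ?case using torsion_free[of a c] by (simp add: mult.commute)
next
  case (insert k J)
  define R where "R = (\<Sum>j\<in>J. f j)"
  have k: "f k \<in> P" "(f k)\<^sup>2 - f k \<in> I" "a \<in> P"
    using insert.prems by auto
  have R: "R \<in> P" unfolding R_def using insert.prems by (intro sum_P) auto
  have all: "a * (of_nat (Suc c) + (f k + R)) \<in> I"
    using insert.prems(4) insert.hyps by (simp add: R_def)
  \<comment> \<open>Multiplying by \<open>f k\<close> selects the part where \<open>f k\<close> is
    1: there it merges into the constant, and the induction hypothesis applies to
    \<open>a * f k\<close>.\<close>
  have "a * f k * (of_nat (Suc (Suc c)) + R) =
      f k * (a * (of_nat (Suc c) + (f k + R))) - a * ((f k)\<^sup>2 - f k)"
    by (simp add: algebra_simps power2_eq_square)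
  also have "\<dots> \<in> I"
    by (rule diff_I[OF mult_I[OF k(1) all] mult_I[OF k(3,2)]])
  finally have "a * f k * (of_nat (Suc (Suc c)) + (\<Sum>j\<in>J. f j)) \<in> I"
    unfolding R_def .
  from insert.IH[OF _ _ _ this] have "a * f k \<in> I"
    using k insert.prems by auto
  \<comment> \<open>Since \<open>a * f k\<close> lies in the ideal, the summand \<open>f k\<close>
    drops out, and the induction hypothesis applies to \<open>a\<close> with the same
    \<open>c\<close>.\<close>
  then have "a * (of_nat (Suc c) + (f k + R)) - a * f k \<in> I"
    using all by auto
  then have "a * (of_nat (Suc c) + (\<Sum>j\<in>J. f j)) \<in> I"
    by (simp add: R_def algebra_simps)
  from insert.IH[OF _ _ _ this] show ?case
    using insert.prems by auto
qed

text \<open>Multiplying the sum by \<open>f k\<close> turns its own term into \<open>f k\<close>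
  modulo \<open>I\<close>; this leaves \<open>f k\<close> times 1 plus the other idempotents, and
  that factor cancels.\<close>

lemma idempotents_sum_in_ideal:
  assumes "finite J" "\<And>j. j \<in> J \<Longrightarrow> f j \<in> P" "\<And>j. j \<in> J \<Longrightarrow> (f j)\<^sup>2 - f j \<in> I"
    and "(\<Sum>j\<in>J. f j) \<in> I" "k \<in> J"
  shows "f k \<in> I"
proof (rule positive_plus_idempotents_cancel[of "J - {k}" f "f k" 0])
  have "f k * (of_nat (Suc 0) + (\<Sum>j\<in>J - {k}. f j)) = f k * (\<Sum>j\<in>J. f j) - ((f k)\<^sup>2 - f k)"
    unfolding sum.remove[OF assms(1,5), of f] by (simp add: algebra_simps power2_eq_square)
  also have "\<dots> \<in> I"
    using assms(2-5) by (intro diff_I[OF mult_I]) auto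
  finally show "f k * (of_nat (Suc 0) + (\<Sum>j\<in>J - {k}. f j)) \<in> I" .
qed (use assms in auto)

text \<open>Every factor \<open>1 - f j * g j\<close> acts as 1 on \<open>a\<close>, because
  \<open>a * f j\<close> vanishes modulo \<open>I\<close>.\<close>

lemma mult_one_minus_prod:
  assumes "a \<in> P" "\<And>j. j \<in> J \<Longrightarrow> f j \<in> P" "\<And>j. j \<in> J \<Longrightarrow> g j \<in> P" "\<And>j. j \<in> J \<Longrightarrow> a * f j \<in> I"
  shows "a * (1 - (\<Prod>j\<in>J. 1 - f j * g j)) \<in> I"
  using assms(2-)
proof (induction J rule: infinite_finite_induct)
  case (insert k J)
  define R where "R = (\<Prod>j\<in>J. 1 - f j * g j)"
  have R: "R \<in> P" unfolding R_def using insert.prems by (intro prod_P) auto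
  have "a * (1 - R) \<in> I" unfolding R_def using insert by auto
  moreover have "g k * R * (a * f k) \<in> I"
    using insert.prems R mult_I[of "g k * R" "a * f k"] by auto
  moreover have "a * (1 - (\<Prod>j\<in>insert k J. 1 - f j * g j)) = a * (1 - R) + g k * R * (a * f k)"
    using insert.hyps by (simp add: R_def algebra_simps)
  ultimately show ?case by auto
qed auto

text \<open>At a common zero with \<open>x h = x h' = 0\<close>, both \<open>h\<close> and \<open>h'\<close> have a neighbour outside
  \<open>{h, h'}\<close>, so the remaining \<open>card V - 2\<close> vertices are dominating.\<close>

lemma undominated_pair:
  assumes V: "finite V" "h \<in> V" "h' \<in> V" "h \<noteq> h'"
    and x: "\<And>a. a \<in> V \<Longrightarrow> x a \<in> P" "\<And>a. a \<in> V \<Longrightarrow> (x a)\<^sup>2 - x a \<in> I"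
    and e: "\<And>a b. a \<in> V \<Longrightarrow> b \<in> V \<Longrightarrow> a \<noteq> b \<Longrightarrow> e a b \<in> P"
      "\<And>a b. a \<in> V \<Longrightarrow> b \<in> V \<Longrightarrow> a \<noteq> b \<Longrightarrow> (e a b)\<^sup>2 - e a b \<in> I"
      "\<And>a b. e a b = e b a"
    and S: "S = V - {h, h'}" "(\<Prod>v'\<in>V - S. \<Sum>v\<in>S. e v v') \<in> I"
    and dom: "\<And>a. a \<in> V \<Longrightarrow> (1 - x a) * (\<Prod>b\<in>V - {a}. 1 - e a b * x b) \<in> I"
  shows "(1 - x h) * (1 - x h') \<in> I"
proof -
  have VS: "V - S = {h, h'}" using V S by auto
  have "(\<Sum>v\<in>S. e v h) * (\<Sum>v\<in>S. e v h') \<in> I"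
    using S(2) V(4) unfolding VS by simp
  then have sum: "(\<Sum>(a, b)\<in>S \<times> S. e a h * e b h') \<in> I"
    by (simp add: sum_product sum.cartesian_product)
  have ee: "e a h * e b h' \<in> I" if "a \<in> S" "b \<in> S" for a b
    using idempotents_sum_in_ideal[OF _ _ _ sum, of "(a, b)"] that V S(1)
    by (force intro!: idempotent_mult e)
  \<comment> \<open>At a 0/1 zero, \<open>A k\<close> is 1 if no neighbour \<open>a\<close> of
    \<open>k\<close> in \<open>S\<close> has \<open>x a = 1\<close>, and 0 otherwise.\<close>
  define A where "A k = (\<Prod>a\<in>S. 1 - e a k * x a)" for k
  have A: "A h \<in> P" "A h' \<in> P"
    unfolding A_def by (intro prod_P diff_P one_P mult_P e x; use V S(1) in auto)+
  have "e a h * (1 - A h') \<in> I" if "a \<in> S" for a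
    unfolding A_def using that V S(1) x e ee by (intro mult_one_minus_prod) auto
  \<comment> \<open>The relation \<open>ee\<close> is passed through the two products one after the
    other: first \<open>e a h\<close> kills \<open>1 - A h'\<close>, then \<open>1 - A h'\<close>
    kills \<open>1 - A h\<close>.\<close>
  then have AA: "(1 - A h') * (1 - A h) \<in> I"
    unfolding A_def[of h] using A(2) V S(1) x e
    by (intro mult_one_minus_prod) (auto simp: mult.commute)
  \<comment> \<open>If neither \<open>k\<close> nor \<open>l\<close> is chosen, \<open>k\<close>
    must be dominated from \<open>S\<close>: the factor of \<open>l\<close> in \<open>dom\<close>
    becomes 1, since \<open>(1 - x l) * x l\<close> vanishes modulo \<open>I\<close>.\<close>
  have qA: "(1 - x k) * (1 - x l) * A k \<in> I" if kl: "{k, l} = {h, h'}" for k l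
  proof -
    have kl': "k \<in> V" "l \<in> V" "k \<noteq> l" "V - {k} = insert l S" "l \<notin> S" "finite S"
      using kl V S(1) by (auto simp: doubleton_eq_iff)
    have "A k \<in> P" using A kl by (auto simp: doubleton_eq_iff)
    have "(\<Prod>b\<in>V - {k}. 1 - e k b * x b) = (1 - e k l * x l) * A k"
      using kl' e(3) by (simp add: A_def)
    then have "(1 - x k) * ((1 - e k l * x l) * A k) \<in> I"
      using dom[OF kl'(1)] by simp
    then have "(1 - x l) * ((1 - x k) * ((1 - e k l * x l) * A k))
        - (1 - x k) * A k * e k l * ((x l)\<^sup>2 - x l) \<in> I"
      using kl' x e \<open>A k \<in> P\<close> by (intro diff_I[OF mult_I mult_I]) (auto intro!: mult_P)
    then show ?thesis by (simp add: algebra_simps power2_eq_square)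
  qed
  define q where "q = (1 - x h) * (1 - x h')"
  have q: "q \<in> P" unfolding q_def using V x by auto
  have "q * A h \<in> I" "q * A h' \<in> I"
    using qA[of h h'] qA[of h' h] by (auto simp: q_def ac_simps)
  moreover have "q * ((1 - A h') * (1 - A h)) \<in> I"
    by (rule mult_I[OF q AA])
  moreover have "(1 - A h') * (q * A h) \<in> I"
    using calculation(1) A by (intro mult_I[of "1 - A h'"]) auto
  \<comment> \<open>The three terms add up to \<open>q\<close>, by expanding
    \<open>1 = (1 - A h') * ((1 - A h) + A h) + A h'\<close>.\<close>
  ultimately have "q * ((1 - A h') * (1 - A h)) + (1 - A h') * (q * A h) + q * A h' \<in> I"
    by blast
  then have "q \<in> I" by (simp add: algebra_simps)
  then show ?thesis unfolding q_def .
qed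

text \<open>The complements \<open>1 - x a\<close> are pairwise orthogonal idempotents, so their sum
  \<open>Y\<close> is idempotent, and so is \<open>z = 1 - Y\<close>.\<close>

lemma at_most_one_zero:
  assumes "finite V" "V \<noteq> {}"
    and x: "\<And>a. a \<in> V \<Longrightarrow> x a \<in> P" "\<And>a. a \<in> V \<Longrightarrow> (x a)\<^sup>2 - x a \<in> I"
    and xx: "\<And>a b. a \<in> V \<Longrightarrow> b \<in> V \<Longrightarrow> a \<noteq> b \<Longrightarrow> (1 - x a) * (1 - x b) \<in> I"
    and z: "z = (\<Sum>a\<in>V. x a) - of_nat (card V - 1)"
  shows "z\<^sup>2 - z \<in> I"
proof -
  define y where "y a = 1 - x a" for a
  define Y where "Y = (\<Sum>a\<in>V. y a)"
  \<comment> \<open>Nonemptiness of \<open>V\<close> keeps the natural-number subtraction from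
    truncating.\<close>
  have "of_nat (card V) = (1 + of_nat (card V - 1) :: 'r)"
    using assms(1,2) by (metis Suc_pred' card_gt_0_iff of_nat_Suc)
  then have zY: "z = 1 - Y"
    by (simp add: z Y_def y_def sum_subtractf)
  have "Y\<^sup>2 = (\<Sum>a\<in>V. y a * Y)"
    by (simp add: power2_eq_square Y_def sum_distrib_right)
  also have "\<dots> = (\<Sum>a\<in>V. (y a)\<^sup>2 + (\<Sum>b\<in>V - {a}. y a * y b))"
  proof (intro sum.cong refl)
    fix a assume "a \<in> V"
    show "y a * Y = (y a)\<^sup>2 + (\<Sum>b\<in>V - {a}. y a * y b)"
      unfolding Y_def sum.remove[OF assms(1) \<open>a \<in> V\<close>, of y]
      by (simp add: distrib_left sum_distrib_left power2_eq_square)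
  qed
  finally have "Y\<^sup>2 - Y = (\<Sum>a\<in>V. ((y a)\<^sup>2 - y a) + (\<Sum>b\<in>V - {a}. y a * y b))"
    by (simp only: sum.distrib sum_subtractf Y_def[symmetric]) simp
  moreover have "z\<^sup>2 - z = Y\<^sup>2 - Y"
    by (simp add: zY power2_eq_square algebra_simps)
  ultimately have "z\<^sup>2 - z = (\<Sum>a\<in>V. ((y a)\<^sup>2 - y a) + (\<Sum>b\<in>V - {a}. y a * y b))"
    by simp
  also have "\<dots> \<in> I"
  proof (intro sum_I add_I)
    fix a assume "a \<in> V"
    moreover have "(y a)\<^sup>2 - y a = (x a)\<^sup>2 - x a"
      by (simp add: y_def power2_eq_square algebra_simps)
    ultimately show "(y a)\<^sup>2 - y a \<in> I" using x by simp
  qed (use xx in \<open>auto simp: y_def\<close>)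
  finally show ?thesis .
qed

end


section \<open>The Vizing ideal\<close>

lemma Const_simps:
  "Const 0 = 0" "Const 1 = 1" "Const (a + b) = Const a + Const b"
  "Const (a * b) = Const a * Const b" "Const (- a) = - Const a" "Const (a - b) = Const a - Const b"
  unfolding Const_def
  by (rule single_zero single_one single_add single_uminus single_diff | simp only: mult_single add_0)+

lemma Const_sum: "Const (\<Sum>i\<in>A. f i) = (\<Sum>i\<in>A. Const (f i))"
  by (induction A rule: infinite_finite_induct) (simp_all add: Const_simps)

lemma Const_of_nat: "Const (of_nat n) = of_nat n"
  by (induction n) (simp_all add: Const_simps)

lemma polys_over_Const: "c \<in> K \<Longrightarrow> Const c \<in> polys_over K vs"
  by (auto simp: polys_over_def Const_def)

lemma subfield_real_inverse:
  assumes K: "subfield K real_ring" and "c \<in> K" "c \<noteq> 0"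
  shows "1 / c \<in> K"
proof -
  interpret R: cring real_ring by (rule cring_from_type_algebra)
  have "c \<in> K - {\<zero>\<^bsub>real_ring\<^esub>}"
    using assms by (simp add: ring_of_type_algebra_def)
  from R.subfield_m_inv[OF K this]
  have "inv\<^bsub>real_ring\<^esub> c \<in> K" "c * inv\<^bsub>real_ring\<^esub> c = 1"
    by (simp_all add: ring_of_type_algebra_def)
  then show ?thesis
    using assms(3) by (metis nonzero_mult_div_cancel_left)
qed

lemma viz_ideal_torsion_free:
  fixes VG DG :: "'a set" and VH DH :: "'b set"
  assumes K: "subfield K real_ring" and D: "DG \<subseteq> VG" "DH \<subseteq> VH"
  shows "torsion_free_ideal (polys_over K (viz_vars VG VH)) (viz_ideal K VG DG VH DH)"
proof -
  note KD = subfield_real_ringD[OF K]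
  interpret J: ideal "viz_ideal K VG DG VH DH" "viz_ring K VG VH"
    by (rule ideal_viz_ideal[OF K D])
  have mult: "p * a \<in> viz_ideal K VG DG VH DH"
    if "p \<in> polys_over K (viz_vars VG VH)" "a \<in> viz_ideal K VG DG VH DH" for p a
    using J.I_l_closed[OF that(2), of p] that(1)
    by (simp add: viz_ring_def poly_ring_over_def ring_of_type_algebra_def)
  have real_of_nat: "real n \<in> K" for n
    by (induction n) (auto intro: KD)
  show ?thesis
  proof
    show "1 \<in> polys_over K (viz_vars VG VH)" by (rule polys_over_one[OF KD(2)])
    show "0 \<in> viz_ideal K VG DG VH DH"
      using additive_subgroup.zero_closed[OF J.is_additive_subgroup]
      by (simp add: viz_ring_def poly_ring_over_def ring_of_type_algebra_def)
    show "a + b \<in> viz_ideal K VG DG VH DH"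
      if "a \<in> viz_ideal K VG DG VH DH" "b \<in> viz_ideal K VG DG VH DH" for a b
      using additive_subgroup.a_closed[OF J.is_additive_subgroup that]
      by (simp add: viz_ring_def poly_ring_over_def ring_of_type_algebra_def)
    show "a \<in> viz_ideal K VG DG VH DH"
      if "of_nat (Suc n) * a \<in> viz_ideal K VG DG VH DH" for a n
    proof -
      \<comment> \<open>A subfield of the reals contains the inverses of positive integers, so this
        constant is an admissible multiplier.\<close>
      have "Const (1 / real (Suc n)) * (of_nat (Suc n) * a) \<in> viz_ideal K VG DG VH DH"
        by (intro mult that polys_over_Const subfield_real_inverse[OF K] real_of_nat) simp
      moreover have one: "Const (1 / real (Suc n)) * of_nat (Suc n) = (1 :: ('a, 'b) viz_var rpoly)"
        unfolding Const_of_nat[symmetric] Const_simps(4)[symmetric] by (simp add: Const_simps)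
      ultimately show ?thesis by (simp only: mult.assoc[symmetric] one mult_1_left)
    qed
    show "p + q \<in> polys_over K (viz_vars VG VH)" "p - q \<in> polys_over K (viz_vars VG VH)"
      "p * q \<in> polys_over K (viz_vars VG VH)"
      if "p \<in> polys_over K (viz_vars VG VH)" "q \<in> polys_over K (viz_vars VG VH)" for p q
      using that KD by (blast intro: polys_over_add polys_over_mult polys_over_diff[OF K])+
  qed (rule mult)
qed

lemma viz_gens_in_ideal:
  "dom_gens eG VG DG \<subseteq> viz_ideal K VG DG VH DH"
  "dom_gens eH VH DH \<subseteq> viz_ideal K VG DG VH DH"
  "box_gens VG VH \<subseteq> viz_ideal K VG DG VH DH"
proof -
  have "S \<subseteq> Idl\<^bsub>R\<^esub> S" for R :: "('a, 'b) viz_var rpoly ring" and S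
    by (auto simp: genideal_def)
  then show "dom_gens eG VG DG \<subseteq> viz_ideal K VG DG VH DH"
    "dom_gens eH VH DH \<subseteq> viz_ideal K VG DG VH DH"
    "box_gens VG VH \<subseteq> viz_ideal K VG DG VH DH"
    unfolding viz_ideal_def by (meson le_sup_iff)+
qed

text \<open>For a fixed \<open>g\<close>, the row \<open>xx g\<close> is treated as the indicator of
  a vertex set in the second graph. Once the edges at \<open>g\<close> vanish, the product condition
  becomes domination inside that row.\<close>

lemma viz_row_sum_idempotent:
  fixes VG :: "'a set" and VH :: "'b set"
  assumes K: "subfield K real_ring"
    and fin: "finite VG" "finite VH"
    and DH: "DH \<subseteq> VH" "card DH = card VH - 1" "card VH \<ge> 2"
    and g: "g \<in> VG"
    and z: "z = (\<Sum>h\<in>VH. xx g h) - of_nat (card VH - 1)"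
  shows "z\<^sup>2 - z \<in> viz_ideal K VG VG VH DH"
proof -
  define P where "P = polys_over K (viz_vars VG VH)"
  define I where "I = viz_ideal K VG VG VH DH"
  interpret torsion_free_ideal P I
    unfolding P_def I_def by (rule viz_ideal_torsion_free[OF K subset_refl DH(1)])
  note gens = viz_gens_in_ideal[where K = K and VG = VG and DG = VG and VH = VH and DH = DH, folded I_def]
  note one = subfield_real_ringD(2)[OF K]
  have eG: "eG a b \<in> P" "(eG a b)\<^sup>2 - (eG a b :: ('a, 'b) viz_var rpoly) \<in> I"
    if "a \<in> VG" "b \<in> VG" "a \<noteq> b" for a b
  proof -
    show "eG a b \<in> P"
      unfolding P_def by (intro polys_over_Var one) (use that in \<open>auto simp: viz_vars_def\<close>)
    show "(eG a b)\<^sup>2 - (eG a b :: ('a, 'b) viz_var rpoly) \<in> I"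
      using gens(1) that unfolding dom_gens_def by blast
  qed
  have eH: "eH a b \<in> P" "(eH a b)\<^sup>2 - (eH a b :: ('a, 'b) viz_var rpoly) \<in> I"
    if "a \<in> VH" "b \<in> VH" "a \<noteq> b" for a b
  proof -
    show "eH a b \<in> P"
      unfolding P_def by (intro polys_over_Var one) (use that in \<open>auto simp: viz_vars_def\<close>)
    show "(eH a b)\<^sup>2 - (eH a b :: ('a, 'b) viz_var rpoly) \<in> I"
      using gens(2) that unfolding dom_gens_def by blast
  qed
  have x: "xx a b \<in> P" "(xx a b)\<^sup>2 - xx a b \<in> I" if "a \<in> VG" "b \<in> VH" for a b
  proof -
    show "xx a b \<in> P"
      unfolding P_def by (intro polys_over_Var one) (use that in \<open>auto simp: viz_vars_def\<close>)
    show "(xx a b)\<^sup>2 - xx a b \<in> I"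
      using gens(3) that unfolding box_gens_def by blast
  qed
  \<comment> \<open>Here the fixed dominating set is all of \<open>VG\<close>, so
    \<open>VG - {g}\<close> has the size required by the third family; its generator has a single
    factor, the sum of the edge variables at \<open>g\<close>.\<close>
  have no_edge: "eG g g' \<in> I" if g': "g' \<in> VG - {g}" for g'
  proof -
    define S where "S = VG - {g}"
    have "S \<subseteq> VG" "card S = card VG - 1" "VG - S = {g}"
      unfolding S_def using g fin by auto
    then have "(\<Prod>v'\<in>VG - S. \<Sum>v\<in>S. eG v v') \<in> I"
      using gens(1) unfolding dom_gens_def by blast
    then have "(\<Sum>v\<in>S. eG v g) \<in> I"
      unfolding \<open>VG - S = {g}\<close> by simp
    then have "eG g' g \<in> I"
      by (rule idempotents_sum_in_ideal[rotated 3]) (use g g' fin eG S_def in auto)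
    then show ?thesis by (simp add: insert_commute)
  qed
  have dom: "(1 - xx g h) * (\<Prod>h'\<in>VH - {h}. 1 - eH h h' * xx g h') \<in> I"
    if h: "h \<in> VH" for h
  proof -
    define B where "B = (\<Prod>h'\<in>VH - {h}. 1 - eH h h' * xx g h')"
    define C where "C = (\<Prod>g'\<in>VG - {g}. 1 - eG g g' * xx g' h)"
    have B: "B \<in> P" unfolding B_def using g h by (auto intro!: prod_P eH x)
    have "(1 - xx g h) * C * B \<in> I"
      using gens(3) g h unfolding B_def C_def box_gens_def by blast
    \<comment> \<open>By \<open>no_edge\<close>, \<open>C\<close> is 1 modulo \<open>I\<close>;
      adding this to the box generator removes the factor \<open>C\<close>.\<close>
    moreover have "(1 - xx g h) * B * (1 - C) \<in> I"
      unfolding C_def using g h B no_edge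
      by (intro mult_one_minus_prod) (auto intro!: mult_I x eG)
    ultimately have "(1 - xx g h) * C * B + (1 - xx g h) * B * (1 - C) \<in> I"
      by auto
    then show ?thesis by (simp add: B_def algebra_simps)
  qed
  have pair: "(1 - xx g h) * (1 - xx g h') \<in> I"
    if h: "h \<in> VH" "h' \<in> VH" "h \<noteq> h'" for h h'
  proof -
    define S where "S = VH - {h, h'}"
    \<comment> \<open>Both sizes are \<open>card VH - 2\<close>, so \<open>S\<close> indexes a
      generator of the third family for the second graph.\<close>
    have "S \<subseteq> VH" "card S = card DH - 1"
      unfolding S_def using h fin DH by (auto simp: card_Diff_subset)
    then have "(\<Prod>v'\<in>VH - S. \<Sum>v\<in>S. eH v v') \<in> I"
      using gens(2) unfolding dom_gens_def by blast
    from undominated_pair[OF fin(2) h, of "xx g" eH S, OF _ _ _ _ _ S_def this dom]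
    show ?thesis using g x eH by (auto simp: insert_commute)
  qed
  have "VH \<noteq> {}" using DH(3) by auto
  from at_most_one_zero[OF fin(2) this _ _ pair z] x g show ?thesis
    unfolding I_def by auto
qed


section \<open>The sum of squares\<close>

text \<open>The vectors \<open>(lam g 1, \<dots>, lam g (n - 1), 1) / sqrt n\<close> form an orthonormal basis.\<close>

lemma sum_squares_simplex:
  fixes L :: "'g \<Rightarrow> nat \<Rightarrow> 'r::comm_ring_1" and Y :: "'g \<Rightarrow> 'r"
  assumes "finite V" and N: "N = of_nat (card V)" and c: "c\<^sup>2 * N = 1"
    and diag: "\<And>g. g \<in> V \<Longrightarrow> (\<Sum>i\<in>J. (L g i)\<^sup>2) = N - 1"
    and off: "\<And>g g'. g \<in> V \<Longrightarrow> g' \<in> V \<Longrightarrow> g \<noteq> g' \<Longrightarrow> (\<Sum>i\<in>J. L g i * L g' i) = - 1"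
  shows "(\<Sum>i\<in>J. (c * (\<Sum>g\<in>V. L g i * Y g))\<^sup>2) + (c * (- (N * k) + (\<Sum>g\<in>V. Y g)))\<^sup>2
      = (\<Sum>g\<in>V. (Y g - k)\<^sup>2)"
proof -
  define S where "S = (\<Sum>g\<in>V. Y g)"
  define Q where "Q = (\<Sum>g\<in>V. (Y g)\<^sup>2)"
  have "(\<Sum>i\<in>J. (\<Sum>g\<in>V. L g i * Y g)\<^sup>2)
      = (\<Sum>i\<in>J. \<Sum>g\<in>V. \<Sum>g'\<in>V. (L g i * L g' i) * (Y g * Y g'))"
    by (simp add: power2_eq_square sum_product ac_simps)
  also have "\<dots> = (\<Sum>g\<in>V. \<Sum>i\<in>J. \<Sum>g'\<in>V. (L g i * L g' i) * (Y g * Y g'))"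
    by (rule sum.swap)
  also have "\<dots> = (\<Sum>g\<in>V. \<Sum>g'\<in>V. (\<Sum>i\<in>J. L g i * L g' i) * (Y g * Y g'))"
    unfolding sum_distrib_right by (intro sum.cong refl sum.swap)
  \<comment> \<open>The inner products are \<open>N - 1\<close> on the diagonal and
    \<open>-1\<close> off it, that is, \<open>N\<close> times the identity matrix minus the all-ones
    matrix.\<close>
  also have "\<dots> = (\<Sum>g\<in>V. \<Sum>g'\<in>V. (if g' = g then N * (Y g * Y g') else 0) - Y g * Y g')"
    using diag off by (intro sum.cong refl) (auto simp: left_diff_distrib power2_eq_square)
  also have "\<dots> = N * Q - S\<^sup>2"
    using assms(1)
    by (simp add: sum_subtractf Q_def S_def power2_eq_square sum_distrib_left[of N] sum_product)
  finally have "(\<Sum>i\<in>J. (c * (\<Sum>g\<in>V. L g i * Y g))\<^sup>2) = c\<^sup>2 * (N * Q - S\<^sup>2)"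
    by (simp only: power_mult_distrib flip: sum_distrib_left)
  \<comment> \<open>The term with the square of \<open>S\<close> cancels the one left over from the
    other squares; the rest is grouped around \<open>c\<^sup>2 * N\<close>, which equals 1.\<close>
  moreover have "(c * (- (N * k) + S))\<^sup>2 = c\<^sup>2 * S\<^sup>2 + (c\<^sup>2 * N) * (N * k\<^sup>2 - 2 * k * S)"
    by (simp add: power2_eq_square algebra_simps)
  moreover have "c\<^sup>2 * (N * Q - S\<^sup>2) = (c\<^sup>2 * N) * Q - c\<^sup>2 * S\<^sup>2"
    by (simp add: algebra_simps)
  moreover have "(\<Sum>g\<in>V. (Y g - k)\<^sup>2) = (\<Sum>g\<in>V. (Y g)\<^sup>2 - (2 * k) * Y g + k\<^sup>2)"
    by (intro sum.cong refl) (simp add: power2_eq_square algebra_simps)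
  then have "(\<Sum>g\<in>V. (Y g - k)\<^sup>2) = Q - 2 * k * S + N * k\<^sup>2"
    by (simp add: sum.distrib sum_subtractf Q_def S_def N flip: sum_distrib_left)
  ultimately show ?thesis
    by (simp only: c flip: S_def) (simp add: algebra_simps)
qed

section \<open>Bounds on the total degree\<close>

lemma total_degree_le_iff:
  "total_degree p \<le> l \<longleftrightarrow>
     (\<forall>m\<in>Poly_Mapping.keys p. (\<Sum>v\<in>Poly_Mapping.keys m. Poly_Mapping.lookup m v) \<le> l)"
  by (auto simp: total_degree_def)

lemma total_degree_sum_le:
  assumes "\<And>i. i \<in> A \<Longrightarrow> total_degree (f i) \<le> l"
  shows "total_degree (\<Sum>i\<in>A. f i) \<le> l"
  using assms
proof (induction A rule: infinite_finite_induct)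
  case (insert a A)
  then show ?case
    using keys_add[of "f a" "sum f A"] by (fastforce simp: total_degree_le_iff)
qed (auto simp: total_degree_def)

lemma total_degree_add_le:
  assumes "total_degree p \<le> l" "total_degree q \<le> l"
  shows "total_degree (p + q) \<le> l"
  using assms keys_add[of p q] by (fastforce simp: total_degree_le_iff)

lemma total_degree_Const_mult_le:
  assumes "total_degree p \<le> l"
  shows "total_degree (Const c * p) \<le> l"
  using assms keys_mult[of "Const c" p]
  by (fastforce simp: total_degree_le_iff Const_def split: if_splits)

lemma total_degree_Const: "total_degree (Const c) = 0"
  by (auto simp: total_degree_def Const_def)

lemma total_degree_Var: "total_degree (Var v) = 1"
  by (auto simp: total_degree_def Var_def)


section \<open>Vizing's inequality\<close>

lemma finite_dominating_sets: "finite V \<Longrightarrow> finite {D. dominating_set V E D}"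
  by (rule finite_subset[of _ "Pow V"]) (auto simp: dominating_set_def)

lemma domination_number_le:
  assumes "finite V" "dominating_set V E D"
  shows "domination_number V E \<le> card D"
  unfolding domination_number_def
  using assms by (intro Min_le finite_imageI finite_dominating_sets) auto

lemma domination_number_attained:
  assumes "finite V"
  obtains D where "dominating_set V E D" "card D = domination_number V E"
proof -
  have "dominating_set V E V" by (simp add: dominating_set_def)
  then have "domination_number V E \<in> card ` {D. dominating_set V E D}"
    unfolding domination_number_def
    using assms by (intro Min_in finite_imageI finite_dominating_sets) auto
  then show thesis using that by auto
qed

text \<open>Deleting one endpoint of an edge would leave a smaller dominating set, as the other
  endpoint dominates the deleted vertex.\<close>

lemma full_domination_number_no_edges:
  assumes "simple_graph U E" "domination_number U E = card U"
  shows "{u, v} \<notin> E"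
proof
  assume "{u, v} \<in> E"
  with assms(1) have uv: "u \<in> U" "v \<in> U" "u \<noteq> v" "finite U"
    by (auto simp: simple_graph_def card_2_iff doubleton_eq_iff)
  have "dominating_set U E (U - {u})"
    using uv \<open>{u, v} \<in> E\<close> by (auto simp: dominating_set_def insert_commute)
  then have "card U \<le> card (U - {u})"
    using domination_number_le[OF uv(4)] assms(2) by metis
  with card_Diff1_less[OF uv(4,1)] show False by simp
qed

text \<open>Without edges in the first graph, every edge of the product stays inside one copy of
  \<open>W\<close>. A dominating set is thus a disjoint union of dominating sets of the copies, one
  for each vertex of \<open>U\<close>.\<close>

lemma vizing_full_domination_number:
  assumes U: "simple_graph U E" "domination_number U E = card U"
    and W: "simple_graph W F"
  shows "domination_number U E * domination_number W F
    \<le> domination_number (U \<times> W) (box_edges U E W F)"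
proof -
  have fin: "finite U" "finite W" using U W by (auto simp: simple_graph_def)
  obtain D where D: "dominating_set (U \<times> W) (box_edges U E W F) D"
    "card D = domination_number (U \<times> W) (box_edges U E W F)"
    using domination_number_attained[of "U \<times> W"] fin by blast
  have sub: "D \<subseteq> U \<times> W" using D by (simp add: dominating_set_def)
  have slice: "dominating_set W F (D `` {u})" if u: "u \<in> U" for u
    unfolding dominating_set_def
  proof (intro conjI ballI)
    show "D `` {u} \<subseteq> W" using sub by auto
    fix w assume w: "w \<in> W - D `` {u}"
    then obtain p where p: "p \<in> D" "{p, (u, w)} \<in> box_edges U E W F"
      using D(1) u by (fastforce simp: dominating_set_def)
    then obtain w' where "p = (u, w')" "{w', w} \<in> F"
      using full_domination_number_no_edges[OF U]
      by (auto simp: box_edges_def doubleton_eq_iff insert_commute)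
    with p show "\<exists>w'\<in>D `` {u}. {w', w} \<in> F" by auto
  qed
  have "D = Sigma U (\<lambda>u. D `` {u})" using sub by auto
  moreover have "card (Sigma U (\<lambda>u. D `` {u})) = (\<Sum>u\<in>U. card (D `` {u}))"
    using fin slice by (intro card_SigmaI ballI) (auto simp: dominating_set_def intro: finite_subset)
  moreover have "(\<Sum>u\<in>U. domination_number W F) \<le> (\<Sum>u\<in>U. card (D `` {u}))"
    by (intro sum_mono domination_number_le fin slice)
  ultimately show ?thesis using D(2) U(2) by simp
qed


section \<open>Assembling the certificate and deducing Vizing's inequality\<close>

theorem theoremA1:
  fixes K :: "real set"
    and VG DG :: "'a set" and VH DH :: "'b set"
    and nG kG nH kH :: nat
    and lam :: "'a \<Rightarrow> nat \<Rightarrow> real"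
    and s :: "nat \<Rightarrow> ('a, 'b) viz_var rpoly"
  assumes "finite VG" "card VG = nG" "DG \<subseteq> VG" "card DG = kG"
    and "finite VH" "card VH = nH" "DH \<subseteq> VH" "card DH = kH"
    and "kG = nG" "nG \<ge> 1"
    and "kH = nH - 1" "nH - 1 \<ge> 1"
    and "\<forall>g\<in>VG. (\<Sum>i=1..nG - 1. (lam g i)\<^sup>2) = real nG - 1"
    and "\<forall>g\<in>VG. \<forall>g'\<in>VG. g \<noteq> g' \<longrightarrow> (\<Sum>i=1..nG - 1. lam g i * lam g' i) = - 1"
    and "subfield K real_ring" "sqrt (real nG) \<in> K"
    and "\<forall>g\<in>VG. \<forall>i\<in>{1..nG - 1}. lam g i \<in> K"
    and "\<forall>i\<in>{1..nG - 1}.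
           s i = Const (1 / sqrt (real nG)) * (\<Sum>g\<in>VG. Const (lam g i) * (\<Sum>h\<in>VH. xx g h))"
    and "s nG = Const (1 / sqrt (real nG)) *
           (- Const (real kG * real kH) + (\<Sum>g\<in>VG. \<Sum>h\<in>VH. xx g h))"
  shows "sos_certificate (viz_ring K VG VH) 1 (viz_ideal K VG DG VH DH) (f_viz VG DG VH DH)
           {1..nG} s
       \<and> (\<forall>(U :: 'c set) E (W :: 'd set) F.
            simple_graph U E \<and> card U = nG \<and> domination_number U E = nG \<and>
            simple_graph W F \<and> card W = nH \<and> domination_number W F = nH - 1 \<longrightarrow>
            domination_number U E * domination_number W F
              \<le> domination_number (U \<times> W) (box_edges U E W F))"
proof (intro conjI allI impI)
  note K = \<open>subfield K real_ring\<close>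
  note KD = subfield_real_ringD[OF K]
  have DG: "DG = VG" using assms by (metis card_subset_eq)
  have nG: "nG > 0" using assms by simp
  have c: "1 / sqrt (real nG) \<in> K"
    using nG by (intro subfield_real_inverse[OF K]) (use assms in auto)
  have real_of_nat: "real n \<in> K" for n
    by (induction n) (auto intro: KD)
  define Y :: "'a \<Rightarrow> ('a, 'b) viz_var rpoly" where "Y g = (\<Sum>h\<in>VH. xx g h)" for g
  define k :: "('a, 'b) viz_var rpoly" where "k = of_nat (nH - 1)"
  have Y: "Y g \<in> polys_over K (viz_vars VG VH)" if "g \<in> VG" for g
    unfolding Y_def
    by (intro polys_over_sum KD polys_over_Var) (use that in \<open>auto simp: viz_vars_def\<close>)
  have degY: "total_degree (Y g) \<le> 1" for g
    unfolding Y_def by (intro total_degree_sum_le) (simp add: total_degree_Var)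
  have s: "s i = Const (1 / sqrt (real nG)) * (\<Sum>g\<in>VG. Const (lam g i) * Y g)"
    if "i \<in> {1..nG - 1}" for i
    using assms that by (simp add: Y_def)
  have sn: "s nG = Const (1 / sqrt (real nG)) * (Const (- (real kG * real kH)) + (\<Sum>g\<in>VG. Y g))"
    using assms by (simp add: Y_def Const_simps)
  have s_ring: "s i \<in> polys_over K (viz_vars VG VH) \<and> total_degree (s i) \<le> 1"
    if i: "i \<in> {1..nG}" for i
  proof (cases "i = nG")
    case True
    show ?thesis
      unfolding True sn
      by (intro conjI polys_over_mult polys_over_add polys_over_sum polys_over_Const KD c Y
          real_of_nat total_degree_Const_mult_le total_degree_add_le total_degree_sum_le degY)
         (auto simp: total_degree_Const)
  next
    case False
    then have i': "i \<in> {1..nG - 1}" using i by auto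
    show ?thesis
      unfolding s[OF i'] using i' assms
      by (intro conjI polys_over_mult polys_over_sum polys_over_Const KD c Y
          total_degree_Const_mult_le total_degree_sum_le degY) auto
  qed
  have split: "{1..nG} = insert nG {1..nG - 1}" using nG by auto
  have "(\<Sum>i\<in>{1..nG}. (s i)\<^sup>2) = (\<Sum>i\<in>{1..nG - 1}. (s i)\<^sup>2) + (s nG)\<^sup>2"
    unfolding split using nG by (subst sum.insert) auto
  also have "(\<Sum>i\<in>{1..nG - 1}. (s i)\<^sup>2) = (\<Sum>i\<in>{1..nG - 1}.
      (Const (1 / sqrt (real nG)) * (\<Sum>g\<in>VG. Const (lam g i) * Y g))\<^sup>2)"
    using s by simp
  \<comment> \<open>The constant \<open>kG * kH\<close> is \<open>nG\<close> copies of
    \<open>k\<close>, one for each row, because \<open>kG = nG\<close> and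
    \<open>kH = nH - 1\<close>.\<close>
  also have "s nG = Const (1 / sqrt (real nG)) * (- (of_nat nG * k) + (\<Sum>g\<in>VG. Y g))"
    using assms by (simp only: sn k_def Const_simps Const_of_nat)
  also have "(\<Sum>i\<in>{1..nG - 1}. (Const (1 / sqrt (real nG)) * (\<Sum>g\<in>VG. Const (lam g i) * Y g))\<^sup>2)
      + (Const (1 / sqrt (real nG)) * (- (of_nat nG * k) + (\<Sum>g\<in>VG. Y g)))\<^sup>2
      = (\<Sum>g\<in>VG. (Y g - k)\<^sup>2)"
  proof (rule sum_squares_simplex)
    show "finite VG" "of_nat nG = of_nat (card VG)" using assms by auto
    have "(Const (1 / sqrt (real nG)))\<^sup>2 * of_nat nG = Const ((1 / sqrt (real nG))\<^sup>2 * real nG)"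
      by (simp only: power2_eq_square Const_simps Const_of_nat)
    also have "(1 / sqrt (real nG))\<^sup>2 * real nG = 1" using nG by (simp add: power_divide)
    finally show "(Const (1 / sqrt (real nG)))\<^sup>2 * of_nat nG = 1"
      by (simp add: Const_simps)
    show "(\<Sum>i\<in>{1..nG - 1}. (Const (lam g i))\<^sup>2) = of_nat nG - 1" if "g \<in> VG" for g
    proof -
      have "(\<Sum>i\<in>{1..nG - 1}. (Const (lam g i))\<^sup>2) = Const (\<Sum>i=1..nG - 1. (lam g i)\<^sup>2)"
        by (simp only: Const_sum power2_eq_square Const_simps)
      then show ?thesis using assms that by (simp add: Const_simps Const_of_nat)
    qed
    show "(\<Sum>i\<in>{1..nG - 1}. Const (lam g i) * Const (lam g' i)) = - 1"
      if "g \<in> VG" "g' \<in> VG" "g \<noteq> g'" for g g'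
    proof -
      have "(\<Sum>i\<in>{1..nG - 1}. Const (lam g i) * Const (lam g' i))
          = Const (\<Sum>i=1..nG - 1. lam g i * lam g' i)"
        by (simp only: Const_sum Const_simps)
      then show ?thesis using assms that by (simp add: Const_simps)
    qed
  qed
  finally have sos: "(\<Sum>i\<in>{1..nG}. (s i)\<^sup>2) = (\<Sum>g\<in>VG. (Y g - k)\<^sup>2)" .
  have "f_viz VG DG VH DH = (\<Sum>g\<in>VG. Y g) - of_nat nG * k"
    using assms by (simp only: f_viz_def Y_def k_def Const_simps Const_of_nat)
  also have "\<dots> = (\<Sum>g\<in>VG. Y g - k)"
    using assms by (simp add: sum_subtractf)
  \<comment> \<open>The difference splits by rows into the idempotency defects of
    \<open>Y g - k\<close>, each of which lies in the ideal.\<close>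
  finally have f: "f_viz VG DG VH DH - (\<Sum>i\<in>{1..nG}. (s i)\<^sup>2)
      = - (\<Sum>g\<in>VG. (Y g - k)\<^sup>2 - (Y g - k))"
    by (simp only: sos sum_subtractf minus_diff_eq)
  interpret torsion_free_ideal "polys_over K (viz_vars VG VH)" "viz_ideal K VG DG VH DH"
    by (intro viz_ideal_torsion_free K assms)
  have "f_viz VG DG VH DH - (\<Sum>i\<in>{1..nG}. (s i)\<^sup>2) \<in> viz_ideal K VG DG VH DH"
    unfolding f unfolding DG
    by (intro uminus_I[unfolded DG] sum_I[unfolded DG] viz_row_sum_idempotent[OF K])
       (use assms in \<open>auto simp: Y_def k_def\<close>)
  then show "sos_certificate (viz_ring K VG VH) 1 (viz_ideal K VG DG VH DH) (f_viz VG DG VH DH)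
      {1..nG} s"
    using s_ring by (auto simp: sos_certificate_def viz_ring_def poly_ring_over_def)
qed (use vizing_full_domination_number in blast)

end
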